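(* Let $0<a<b<\infty$, $0<c<d<\infty$ and $0<\gamma_1,\gamma_2<1$, and put $\gamma=(\gamma_1,\gamma_2)$. If $f:[a,b]\times[c,d]\to\mathbb{R}$ is continuous, then $$\dim_H \mathrm{Gr}(\mathcal{I}^{\gamma}f)\le \overline{\dim}_B\, \mathrm{Gr}(\mathcal{I}^{\gamma}f)\le 3-\min\{\gamma_1,\gamma_2\},$$ where the graph is taken over $[a,b]\times[c,d]$.
   Context: For $\gamma=(\gamma_1,\gamma_2)$ with $\gamma_1,\gamma_2>0$, the mixed Riemann-Liouville fractional integral of $f$ on $[a,b]\times[c,d]$ is $$\mathcal{I}^{\gamma}f(x,y)=\frac{1}{\Gamma(\gamma_1)\Gamma(\gamma_2)}\int_a^x\int_c^y (x-u)^{\gamma_1-1}(y-v)^{\gamma_2-1}f(u,v)\,du\,dv .$$ $\mathrm{Gr}(g)=\{(x,y,g(x,y)):(x,y)\in[a,b]\times[c,d]\}\subset\mathbb{R}^3$ is the graph of $g$. $\dim_H$ is the Hausdorff dimension. For a nonempty bounded set $E\subset\mathbb{R}^n$, $N_\delta(E)$ is the smallest number of sets of diameter at most $\delta$ that cover $E$, and $\overline{\dim}_B(E)=\limsup_{\delta\to0}\frac{\log N_\delta(E)}{-\log\delta}$ is the upper box dimension. *)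

theory Defs
  imports "HOL-Analysis.Analysis"
begin

text \<open>
  The integrals are Lebesgue integrals. The value of the kernel at \<open>u = x\<close> or \<open>v = y\<close> (where
  \<open>powr\<close> returns 0) is irrelevant, as these points form a null set.
\<close>

definition mixed_RL_integral ::
    "real \<Rightarrow> real \<Rightarrow> real \<times> real \<Rightarrow> (real \<times> real \<Rightarrow> real) \<Rightarrow> real \<times> real \<Rightarrow> real"
  where "mixed_RL_integral a c = (\<lambda>(\<gamma>\<^sub>1, \<gamma>\<^sub>2) f (x, y).
    1 / (Gamma \<gamma>\<^sub>1 * Gamma \<gamma>\<^sub>2) *
      (LINT u:{a..x}|lborel. (LINT v:{c..y}|lborel.
         (x - u) powr (\<gamma>\<^sub>1 - 1) * (y - v) powr (\<gamma>\<^sub>2 - 1) * f (u, v))))"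

definition graph_on :: "(real \<times> real) set \<Rightarrow> (real \<times> real \<Rightarrow> real) \<Rightarrow> (real ^ 3) set"
  where "graph_on S g = {vector [x, y, g (x, y)] | x y. (x, y) \<in> S}"

text \<open>
  Boundedness is required explicitly because \<^const>\<open>diameter\<close> is a real number, with
  an unspecified value on unbounded sets.
\<close>

definition diam_le :: "'a::metric_space set \<Rightarrow> real \<Rightarrow> bool"
  where "diam_le U \<delta> \<longleftrightarrow> bounded U \<and> diameter U \<le> \<delta>"

definition covering_number :: "real \<Rightarrow> 'a::metric_space set \<Rightarrow> nat"
  where "covering_number \<delta> E =
    (LEAST n. \<exists>\<C>. finite \<C> \<and> card \<C> = n \<and> (\<forall>U\<in>\<C>. diam_le U \<delta>) \<and> E \<subseteq> \<Union>\<C>)"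

definition upper_box_dim :: "'a::metric_space set \<Rightarrow> ereal"
  where "upper_box_dim E =
    Limsup (at_right 0) (\<lambda>\<delta>. ereal (ln (real (covering_number \<delta> E)) / - ln \<delta>))"

text \<open>
  \<open>diam_pow s U\<close> is \<open>|U|\<^sup>s\<close> with the usual conventions: the empty set contributes 0, and
  \<open>|U|\<^sup>0 = 1\<close> for every nonempty \<open>U\<close> (whereas \<open>0 powr 0 = 0\<close> in HOL). Since the empty set
  contributes 0, covers by sequences of sets include the finite covers.
\<close>

definition diam_pow :: "real \<Rightarrow> 'a::metric_space set \<Rightarrow> ennreal"
  where "diam_pow s U =
    (if U = {} then 0 else if s = 0 then 1 else ennreal (diameter U powr s))"

definition hausdorff_premeasure :: "real \<Rightarrow> real \<Rightarrow> 'a::metric_space set \<Rightarrow> ennreal"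
  where "hausdorff_premeasure \<delta> s E =
    (INF U\<in>{U :: nat \<Rightarrow> 'a set. (\<forall>i. diam_le (U i) \<delta>) \<and> E \<subseteq> (\<Union>i. U i)}. \<Sum>i. diam_pow s (U i))"

text \<open>
  The premeasure increases as \<open>\<delta>\<close> decreases, so its limit for \<open>\<delta> \<rightarrow> 0\<close> is a supremum.
\<close>

definition hausdorff_measure :: "real \<Rightarrow> 'a::metric_space set \<Rightarrow> ennreal"
  where "hausdorff_measure s E = (SUP \<delta>\<in>{0<..}. hausdorff_premeasure \<delta> s E)"

definition hausdorff_dim :: "'a::metric_space set \<Rightarrow> ereal"
  where "hausdorff_dim E = (INF s\<in>{s. 0 \<le> s \<and> hausdorff_measure s E = 0}. ereal s)"

end

theory Submission
  imports Defs
begin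

text \<open>
  The second inequality rests on a smoothing property of fractional integration: if \<open>0 < \<gamma> \<le> 1\<close> and \<open>h\<close> is
  measurable and bounded by \<open>M\<close>, then \<open>x \<mapsto> \<integral>\<^sub>p\<^sup>x (x - u)\<^sup>\<gamma>\<^sup>-\<^sup>1 h u du\<close> is Hoelder continuous of exponent \<open>\<gamma>\<close>,
  however irregular \<open>h\<close> is (\<open>abel_holder\<close>). The mixed integral is one such integral nested in
  another, so it is Hoelder continuous of exponent \<open>\<gamma>\<^sub>1\<close> in \<open>x\<close> and \<open>\<gamma>\<^sub>2\<close> in \<open>y\<close>
  (\<open>mixed_RL_integral_bounded_and_holder\<close>): for a step in \<open>x\<close> the inner integral serves as the
  bounded density, and a step in \<open>y\<close> changes the inner integral uniformly little.

  Put \<open>\<gamma> = min \<gamma>\<^sub>1 \<gamma>\<^sub>2\<close>. On a square of side \<open>\<eta> \<le> 1\<close> the function then oscillates by at most a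
  multiple of \<open>\<eta>\<^sup>\<gamma>\<close>, so the part of the graph above this square is covered by about \<open>\<eta>\<^sup>\<gamma>\<^sup>-\<^sup>1\<close>
  stacked cubes of side \<open>\<eta>\<close>. There are about \<open>\<eta>\<^sup>-\<^sup>2\<close> squares, hence about \<open>\<eta>\<^sup>\<gamma>\<^sup>-\<^sup>3\<close> cubes suffice, which
  is the bound \<open>3 - \<gamma>\<close> on the upper box dimension (\<open>upper_box_dim_graph_le\<close>).

  The first inequality holds for every bounded set of a Heine-Borel space
  (\<open>hausdorff_dim_le_upper_box_dim\<close>). If \<open>s > t\<close> and \<open>t\<close> exceeds the upper box dimension, there are
  covers by at most \<open>\<delta>\<^sup>-\<^sup>t\<close> sets of diameter at most \<open>\<delta>\<close>. Their \<open>s\<close>-th powers of diameters sum to at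
  most \<open>\<delta>\<^sup>s\<^sup>-\<^sup>t\<close>, which tends to 0.
\<close>

section \<open>Hausdorff dimension and upper box dimension\<close>

lemma covering_number_le:
  assumes "finite \<C>" "\<And>U. U \<in> \<C> \<Longrightarrow> diam_le U \<delta>" "E \<subseteq> \<Union>\<C>"
  shows "covering_number \<delta> E \<le> card \<C>"
  unfolding covering_number_def by (rule Least_le) (use assms in blast)

lemma diam_le_I:
  fixes U :: "'a::metric_space set"
  assumes "0 \<le> \<delta>" "\<And>x y. x \<in> U \<Longrightarrow> y \<in> U \<Longrightarrow> dist x y \<le> \<delta>"
  shows "diam_le U \<delta>"
proof -
  have "bounded U"
    using assms(2) unfolding bounded_def by blast
  moreover have "diameter U \<le> \<delta>"
    using assms by (auto simp: diameter_def intro!: cSUP_least)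
  ultimately show ?thesis by (simp add: diam_le_def)
qed

text \<open>
  \<^const>\<open>covering_number\<close> is a \<open>LEAST\<close>, which says nothing when no finite cover exists. Relative
  compactness provides one, by balls of radius \<open>\<delta>/2\<close>.
\<close>

lemma covering_number_attained:
  fixes E :: "'a::heine_borel set"
  assumes "bounded E" "0 < \<delta>"
  obtains \<C> where "finite \<C>" "card \<C> = covering_number \<delta> E" "\<And>U. U \<in> \<C> \<Longrightarrow> diam_le U \<delta>" "E \<subseteq> \<Union>\<C>"
proof -
  have "compact (closure E)" using assms by simp
  then obtain k where k: "finite k" "closure E \<subseteq> (\<Union>x\<in>k. ball x (\<delta>/2))"
    using \<open>0 < \<delta>\<close> unfolding compact_eq_totally_bounded by (meson half_gt_zero)
  have "diam_le (ball x (\<delta>/2)) \<delta>" for x :: 'a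
  proof (rule diam_le_I)
    fix y z assume "y \<in> ball x (\<delta>/2)" "z \<in> ball x (\<delta>/2)"
    then show "dist y z \<le> \<delta>"
      using dist_triangle_half_r[of x y \<delta> z] by simp
  qed (use assms in simp)
  then have "\<exists>n \<C>. finite \<C> \<and> card \<C> = n \<and> (\<forall>U\<in>\<C>. diam_le U \<delta>) \<and> E \<subseteq> \<Union>\<C>"
    using k closure_subset[of E] by (intro exI[of _ "card _"] exI[of _ "(\<lambda>x. ball x (\<delta>/2)) ` k"]) auto
  from LeastI_ex[OF this] show ?thesis
    unfolding covering_number_def[symmetric] using that by blast
qed

lemma hausdorff_premeasure_mono:
  assumes "\<delta> \<le> \<delta>'"
  shows "hausdorff_premeasure \<delta>' s E \<le> hausdorff_premeasure \<delta> s E"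
  unfolding hausdorff_premeasure_def
  by (rule INF_superset_mono) (use assms in \<open>auto simp: diam_le_def intro: order_trans\<close>)

text \<open>
  An optimal finite cover, padded with empty sets to a sequence, is admissible for the premeasure.
  The empty sets contribute nothing and each other set at most \<open>\<delta> powr s\<close>.
\<close>

lemma hausdorff_premeasure_le_covering_number:
  fixes E :: "'a::heine_borel set"
  assumes "bounded E" "0 < \<delta>" "0 < s"
  shows "hausdorff_premeasure \<delta> s E \<le> ennreal (real (covering_number \<delta> E) * \<delta> powr s)"
proof -
  obtain \<C> where \<C>: "finite \<C>" "card \<C> = covering_number \<delta> E" "\<And>U. U \<in> \<C> \<Longrightarrow> diam_le U \<delta>" "E \<subseteq> \<Union>\<C>"
    using covering_number_attained[OF assms(1,2)] by blast
  obtain U where U: "bij_betw U {..<card \<C>} \<C>"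
    using ex_bij_betw_nat_finite[OF \<C>(1)] atLeast0LessThan by metis
  define V where "V = (\<lambda>i. if i < card \<C> then U i else {})"
  have V: "diam_le (V i) \<delta>" for i
    using U \<C>(3) assms(2) by (auto simp: V_def diam_le_def bij_betw_def)
  have pow: "diam_pow s (V i) \<le> ennreal (\<delta> powr s)" for i
    using V[of i] assms(3)
    by (auto simp: diam_pow_def diam_le_def intro!: ennreal_leI powr_mono2 diameter_ge_0)
  have "\<Union>\<C> \<subseteq> (\<Union>i. V i)"
    using U by (force simp: V_def bij_betw_def)
  then have "hausdorff_premeasure \<delta> s E \<le> (\<Sum>i. diam_pow s (V i))"
    unfolding hausdorff_premeasure_def using V \<C>(4) by (intro INF_lower) auto
  also have "\<dots> = (\<Sum>i<card \<C>. diam_pow s (V i))"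
    by (rule suminf_finite) (auto simp: V_def diam_pow_def)
  also have "\<dots> \<le> (\<Sum>i<card \<C>. ennreal (\<delta> powr s))"
    by (intro sum_mono pow)
  also have "\<dots> = ennreal (real (covering_number \<delta> E) * \<delta> powr s)"
    by (simp add: \<C>(2) ennreal_mult ennreal_of_nat_eq_real_of_nat)
  finally show ?thesis .
qed

lemma eventually_small: "0 < r \<Longrightarrow> eventually (\<lambda>\<delta>::real. 0 < \<delta> \<and> \<delta> < r) (at_right 0)"
  by (rule eventually_at_rightI[of 0 r]) auto

text \<open>
  For \<open>\<delta> < 1\<close> the logarithmic quotient is nonnegative: a positive covering number is at least 1, and
  the value 0 is harmless because \<open>ln 0 = 0\<close>.
\<close>

lemma upper_box_dim_nonneg: "0 \<le> upper_box_dim E"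
proof -
  have "eventually (\<lambda>\<delta>. 0 \<le> ereal (ln (real (covering_number \<delta> E)) / - ln \<delta>)) (at_right 0)"
    using eventually_small[OF zero_less_one]
  proof eventually_elim
    case (elim \<delta>)
    have "0 \<le> ln (real n)" for n by (cases n) auto
    with elim show ?case by (auto intro!: divide_nonneg_nonpos simp: less_imp_le)
  qed
  then have "0 \<le> Liminf (at_right 0) (\<lambda>\<delta>. ereal (ln (real (covering_number \<delta> E)) / - ln \<delta>))"
    by (rule Liminf_bounded)
  also have "\<dots> \<le> upper_box_dim E"
    unfolding upper_box_dim_def by (intro Liminf_le_Limsup) simp
  finally show ?thesis .
qed

text \<open>
  For \<open>t\<close> strictly between the box dimension and \<open>s\<close>, the covering numbers are eventually at most
  \<open>\<delta> powr - t\<close>, so the premeasure at scale \<open>\<delta>\<close> is at most \<open>\<delta> powr (s - t)\<close>. As the premeasure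
  is antitone in the scale, it vanishes at every scale.
\<close>

lemma hausdorff_measure_eq_0_above_box_dim:
  fixes E :: "'a::heine_borel set"
  assumes "bounded E" "upper_box_dim E < ereal s"
  shows "hausdorff_measure s E = 0"
proof -
  obtain t where t: "upper_box_dim E < ereal t" "t < s"
    using ereal_dense2[OF assms(2)] by auto
  have "0 < t" using upper_box_dim_nonneg[of E] t(1) by (metis ereal_less(2) le_less_trans)
  have ev: "eventually (\<lambda>\<delta>. ereal (ln (real (covering_number \<delta> E)) / - ln \<delta>) < ereal t) (at_right 0)"
    using t(1) unfolding upper_box_dim_def by (rule Limsup_lessD)
  have small: "hausdorff_premeasure \<delta>' s E = 0" if "0 < \<delta>'" for \<delta>'
  proof -
    have "eventually (\<lambda>\<delta>. hausdorff_premeasure \<delta>' s E \<le> ennreal (\<delta> powr (s - t))) (at_right 0)"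
      using ev eventually_small[OF that] eventually_small[OF zero_less_one]
    proof eventually_elim
      case (elim \<delta>)
      have "real (covering_number \<delta> E) \<le> \<delta> powr - t"
      proof (cases "covering_number \<delta> E = 0")
        case False
        have "ln (real (covering_number \<delta> E)) \<le> - t * ln \<delta>"
          using elim by (simp add: field_simps)
        also have "\<dots> = ln (\<delta> powr - t)" using elim by (simp add: ln_powr)
        finally show ?thesis using False elim by (subst (asm) ln_le_cancel_iff) auto
      qed simp
      then have "real (covering_number \<delta> E) * \<delta> powr s \<le> \<delta> powr (- t) * \<delta> powr s"
        by (rule mult_right_mono) simp
      also have "\<dots> = \<delta> powr (s - t)" by (simp add: powr_add[symmetric])
      finally have "ennreal (real (covering_number \<delta> E) * \<delta> powr s) \<le> ennreal (\<delta> powr (s - t))"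
        by (rule ennreal_leI)
      moreover have "hausdorff_premeasure \<delta>' s E \<le> hausdorff_premeasure \<delta> s E"
        using elim by (intro hausdorff_premeasure_mono) auto
      moreover have "hausdorff_premeasure \<delta> s E \<le> ennreal (real (covering_number \<delta> E) * \<delta> powr s)"
        using elim t \<open>0 < t\<close> assms by (intro hausdorff_premeasure_le_covering_number) auto
      ultimately show ?case by (meson order_trans)
    qed
    moreover have "((\<lambda>\<delta>. ennreal (\<delta> powr (s - t))) \<longlongrightarrow> ennreal 0) (at_right 0)"
    proof (rule tendsto_ennrealI)
      have "((\<lambda>\<delta>::real. \<delta> powr (s - t)) \<longlongrightarrow> 0 powr (s - t)) (at_right 0)"
        by (rule tendsto_powr') (use t eventually_at_right_less[of 0] in \<open>auto elim!: eventually_mono\<close>)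
      then show "((\<lambda>\<delta>::real. \<delta> powr (s - t)) \<longlongrightarrow> 0) (at_right 0)" by simp
    qed
    ultimately have "hausdorff_premeasure \<delta>' s E \<le> ennreal 0"
      by (intro tendsto_lowerbound[where F="at_right (0::real)"]) auto
    then show ?thesis by simp
  qed
  show ?thesis unfolding hausdorff_measure_def using small by (auto intro!: antisym SUP_least)
qed

lemma hausdorff_dim_le_upper_box_dim:
  fixes E :: "'a::heine_borel set"
  assumes "bounded E"
  shows "hausdorff_dim E \<le> upper_box_dim E"
proof (rule ereal_le_real)
  fix s assume "upper_box_dim E \<le> ereal s"
  show "hausdorff_dim E \<le> ereal s"
  proof (rule ereal_le_epsilon2)
    fix e :: real assume "0 < e"
    then have "upper_box_dim E < ereal (s + e)"
      using \<open>upper_box_dim E \<le> ereal s\<close> by (simp add: le_less_trans)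
    moreover from this have "0 \<le> s + e"
      using upper_box_dim_nonneg[of E] by (metis ereal_less(2) le_less_trans less_imp_le)
    ultimately show "hausdorff_dim E \<le> ereal s + ereal e"
      unfolding hausdorff_dim_def
      using hausdorff_measure_eq_0_above_box_dim[OF assms, of "s + e"]
      by (auto intro!: INF_lower2[of "s + e"])
  qed
qed

text \<open>
  In the logarithmic quotient the constant \<open>K\<close> contributes \<open>ln K / - ln \<delta>\<close>, which tends to 0. The
  condition \<open>1 \<le> K\<close> makes the logarithm of the bound nonnegative, which covers the convention
  \<open>ln 0 = 0\<close> for a vanishing covering number.
\<close>

lemma upper_box_dim_le:
  fixes E :: "'a::metric_space set"
  assumes "1 \<le> K" "0 < r" "0 \<le> s"
    and K: "\<And>\<delta>. 0 < \<delta> \<Longrightarrow> \<delta> < r \<Longrightarrow> real (covering_number \<delta> E) \<le> K * \<delta> powr - s"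
  shows "upper_box_dim E \<le> ereal s"
proof -
  have "eventually (\<lambda>\<delta>. ereal (ln (real (covering_number \<delta> E)) / - ln \<delta>) \<le> ereal (s + ln K / - ln \<delta>))
      (at_right 0)"
    using eventually_small[OF \<open>0 < r\<close>] eventually_small[OF zero_less_one]
  proof eventually_elim
    case (elim \<delta>)
    have ge1: "1 \<le> \<delta> powr - s" using elim assms(3) by (simp add: powr_minus one_le_inverse powr_le1)
    have "ln (real (covering_number \<delta> E)) \<le> ln (K * \<delta> powr - s)"
    proof (cases "covering_number \<delta> E = 0")
      case True
      have "1 * 1 \<le> K * \<delta> powr - s" using ge1 assms(1) by (intro mult_mono) auto
      with True show ?thesis by simp
    next
      case False
      with K[of \<delta>] elim show ?thesis by (intro ln_mono) auto
    qed
    also have "\<dots> = ln K - s * ln \<delta>" using elim assms(1) by (simp add: ln_mult ln_powr)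
    finally have "ln (real (covering_number \<delta> E)) / - ln \<delta> \<le> (ln K - s * ln \<delta>) / - ln \<delta>"
      using elim by (intro divide_right_mono) auto
    also have "\<dots> = s + ln K / - ln \<delta>" using elim by (simp add: field_simps)
    finally show ?case by simp
  qed
  then have "upper_box_dim E \<le> Limsup (at_right 0) (\<lambda>\<delta>. ereal (s + ln K / - ln \<delta>))"
    unfolding upper_box_dim_def by (rule Limsup_mono)
  also have "\<dots> = ereal s"
  proof (rule lim_imp_Limsup)
    have "((\<lambda>\<delta>. s + ln K / - ln \<delta>) \<longlongrightarrow> s + 0) (at_right 0)"
      by (intro tendsto_add tendsto_const tendsto_divide_0[OF tendsto_const])
        (intro filterlim_at_top_imp_at_infinity filterlim_uminus_at_top[THEN iffD1] ln_at_0 |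
         simp add: filterlim_uminus_at_bot[symmetric] ln_at_0 filterlim_uminus_at_top)+
    then show "((\<lambda>\<delta>. ereal (s + ln K / - ln \<delta>)) \<longlongrightarrow> ereal s) (at_right 0)" by simp
  qed simp
  finally show ?thesis .
qed

section \<open>Box dimension of the graph of a function of two variables\<close>

lemma dist_vector_3_le:
  "dist (vector [x, y, z] :: real ^ 3) (vector [x', y', z']) \<le> \<bar>x - x'\<bar> + \<bar>y - y'\<bar> + \<bar>z - z'\<bar>"
  using norm_le_l1_cart[of "vector [x, y, z] - vector [x', y', z'] :: real ^ 3"]
  by (simp add: dist_norm sum_3)

lemma nat_floor_grid:
  fixes t \<eta> :: real
  assumes "0 \<le> t" "0 < \<eta>"
  shows "real (nat \<lfloor>t / \<eta>\<rfloor>) * \<eta> \<le> t" "t \<le> (real (nat \<lfloor>t / \<eta>\<rfloor>) + 1) * \<eta>"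
proof -
  have "real (nat \<lfloor>t / \<eta>\<rfloor>) = of_int \<lfloor>t / \<eta>\<rfloor>" using assms by simp
  then have "real (nat \<lfloor>t / \<eta>\<rfloor>) \<le> t / \<eta>" "t / \<eta> \<le> real (nat \<lfloor>t / \<eta>\<rfloor>) + 1"
    by linarith+
  then show "real (nat \<lfloor>t / \<eta>\<rfloor>) * \<eta> \<le> t" "t \<le> (real (nat \<lfloor>t / \<eta>\<rfloor>) + 1) * \<eta>"
    using assms by (simp_all only: pos_le_divide_eq pos_divide_le_eq)
qed

text \<open>
  Here \<open>\<omega>\<close> bounds the oscillation of \<open>g\<close> at scale \<open>\<eta>\<close>. The three factors count the grid
  intervals in each direction and the cubes stacked over one grid square. Above the square with lower left
  corner \<open>(X i, Y j)\<close> the graph stays within \<open>\<omega>\<close> of the height \<open>g (X i, Y j)\<close>, so the stack starts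
  at \<open>g (X i, Y j) - \<omega>\<close> and has total height \<open>2 * \<omega>\<close>. A cube of side \<open>\<eta>\<close> has diameter at most
  \<open>3 * \<eta>\<close>.
\<close>

lemma covering_number_graph_le:
  fixes g :: "real \<times> real \<Rightarrow> real"
  assumes "a \<le> b" "c \<le> d" "0 < \<eta>"
    and osc: "\<And>x y x' y'. (x, y) \<in> {a..b} \<times> {c..d} \<Longrightarrow> (x', y') \<in> {a..b} \<times> {c..d} \<Longrightarrow>
      \<bar>x - x'\<bar> \<le> \<eta> \<Longrightarrow> \<bar>y - y'\<bar> \<le> \<eta> \<Longrightarrow> \<bar>g (x, y) - g (x', y')\<bar> \<le> \<omega>"
  shows "real (covering_number (3 * \<eta>) (graph_on ({a..b} \<times> {c..d}) g))
    \<le> ((b - a) / \<eta> + 1) * ((d - c) / \<eta> + 1) * (2 * \<omega> / \<eta> + 1)"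
proof -
  have "0 \<le> \<omega>" using osc[of a c a c] assms(1-3) by auto
  define n where "n = (\<lambda>t. nat \<lfloor>t / \<eta>\<rfloor>)"
  have n_grid: "real (n t) * \<eta> \<le> t" "t \<le> (real (n t) + 1) * \<eta>" if "0 \<le> t" for t
    using nat_floor_grid[OF that \<open>0 < \<eta>\<close>] by (simp_all add: n_def)
  have n_mono: "n t \<le> n t'" if "t \<le> t'" for t t'
    using that \<open>0 < \<eta>\<close> unfolding n_def by (intro nat_mono floor_mono divide_right_mono) auto
  have n_le: "real (n t) + 1 \<le> t / \<eta> + 1" if "0 \<le> t" for t
    using n_grid(1)[OF that] \<open>0 < \<eta>\<close> by (simp add: field_simps)
  define X where "X = (\<lambda>i. a + real i * \<eta>)"
  define Y where "Y = (\<lambda>j. c + real j * \<eta>)"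
  define Z where "Z = (\<lambda>i j k. g (X i, Y j) - \<omega> + real k * \<eta>)"
  define U where "U = (\<lambda>(i, j, k). {vector [x, y, z] :: real ^ 3 | x y z.
      x \<in> {X i..X i + \<eta>} \<and> y \<in> {Y j..Y j + \<eta>} \<and> z \<in> {Z i j k..Z i j k + \<eta>}})"
  define J where "J = {..n (b - a)} \<times> {..n (d - c)} \<times> {..n (2 * \<omega>)}"
  have finJ: "finite J" by (simp add: J_def)
  then have fin: "finite (U ` J)" by simp
  have diam: "diam_le V (3 * \<eta>)" if VJ: "V \<in> U ` J" for V
  proof (rule diam_le_I)
    fix p q assume pq: "p \<in> V" "q \<in> V"
    obtain t where "V = U t" using VJ by blast
    then obtain i j k where V: "V = U (i, j, k)" by (cases t) blast
    obtain x y z where "p = vector [x, y, z]"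
      and "x \<in> {X i..X i + \<eta>}" "y \<in> {Y j..Y j + \<eta>}" "z \<in> {Z i j k..Z i j k + \<eta>}"
      using pq(1) unfolding V U_def prod.case mem_Collect_eq by blast
    moreover obtain x' y' z' where "q = vector [x', y', z']"
      and "x' \<in> {X i..X i + \<eta>}" "y' \<in> {Y j..Y j + \<eta>}" "z' \<in> {Z i j k..Z i j k + \<eta>}"
      using pq(2) unfolding V U_def prod.case mem_Collect_eq by blast
    ultimately show "dist p q \<le> 3 * \<eta>"
      using dist_vector_3_le[of x y z x' y' z'] by auto
  qed (use \<open>0 < \<eta>\<close> in simp)
  have cover: "graph_on ({a..b} \<times> {c..d}) g \<subseteq> \<Union> (U ` J)"
  proof
    fix p assume "p \<in> graph_on ({a..b} \<times> {c..d}) g"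
    then obtain x y where p: "p = vector [x, y, g (x, y)]" and xy: "x \<in> {a..b}" "y \<in> {c..d}"
      by (auto simp: graph_on_def)
    define i where "i = n (x - a)"
    define j where "j = n (y - c)"
    define k where "k = n (g (x, y) - g (X i, Y j) + \<omega>)"
    have i: "X i \<le> x" "x \<le> X i + \<eta>" and j: "Y j \<le> y" "y \<le> Y j + \<eta>"
      using n_grid[of "x - a"] n_grid[of "y - c"] xy
      by (auto simp: X_def Y_def i_def j_def algebra_simps)
    \<comment> \<open>the corner lies below and to the left of \<open>(x, y)\<close>, hence still in the rectangle, where \<open>g\<close> is controlled\<close>
    have "a \<le> X i" "c \<le> Y j" using \<open>0 < \<eta>\<close> by (auto simp: X_def Y_def)
    then have "\<bar>g (x, y) - g (X i, Y j)\<bar> \<le> \<omega>"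
      using i j xy by (intro osc) auto
    then have z: "0 \<le> g (x, y) - g (X i, Y j) + \<omega>" "g (x, y) - g (X i, Y j) + \<omega> \<le> 2 * \<omega>"
      by auto
    have "p \<in> U (i, j, k)"
      using i j n_grid[OF z(1)] by (force simp: U_def p Z_def k_def algebra_simps)
    moreover have "(i, j, k) \<in> J"
      using xy z by (auto simp: J_def i_def j_def k_def intro!: n_mono)
    ultimately show "p \<in> \<Union> (U ` J)" by blast
  qed
  have "real (covering_number (3 * \<eta>) (graph_on ({a..b} \<times> {c..d}) g)) \<le> real (card (U ` J))"
    using covering_number_le[OF fin diam cover] by simp
  also have "\<dots> \<le> real (card J)" using card_image_le[OF finJ, of U] by (simp only: of_nat_le_iff)
  also have "\<dots> = (real (n (b - a)) + 1) * (real (n (d - c)) + 1) * (real (n (2 * \<omega>)) + 1)"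
    by (simp add: J_def card_cartesian_product algebra_simps)
  also have "\<dots> \<le> ((b - a) / \<eta> + 1) * ((d - c) / \<eta> + 1) * (2 * \<omega> / \<eta> + 1)"
    using assms(1-3) \<open>0 \<le> \<omega>\<close> by (intro mult_mono n_le) auto
  finally show ?thesis .
qed

text \<open>
  With \<open>\<omega> = C * \<eta> powr \<gamma>\<close> each of the three counts is dominated by a multiple of \<open>1/\<eta>\<close>, \<open>1/\<eta>\<close> and
  \<open>\<eta> powr (\<gamma> - 1)\<close>. The additive 1 in the last one is absorbed because \<open>\<gamma> \<le> 1\<close>.
\<close>

lemma upper_box_dim_graph_le:
  fixes g :: "real \<times> real \<Rightarrow> real"
  assumes "a \<le> b" "c \<le> d" "0 \<le> C" and \<gamma>: "0 < \<gamma>" "\<gamma> \<le> 1"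
    and osc: "\<And>\<eta> x y x' y'. 0 < \<eta> \<Longrightarrow> \<eta> \<le> 1 \<Longrightarrow>
      (x, y) \<in> {a..b} \<times> {c..d} \<Longrightarrow> (x', y') \<in> {a..b} \<times> {c..d} \<Longrightarrow>
      \<bar>x - x'\<bar> \<le> \<eta> \<Longrightarrow> \<bar>y - y'\<bar> \<le> \<eta> \<Longrightarrow> \<bar>g (x, y) - g (x', y')\<bar> \<le> C * \<eta> powr \<gamma>"
  shows "upper_box_dim (graph_on ({a..b} \<times> {c..d}) g) \<le> ereal (3 - \<gamma>)"
proof (rule upper_box_dim_le)
  define L where "L = (b - a + 1) * (d - c + 1) * (2 * C + 1)"
  have "1 * 1 * 1 \<le> L" unfolding L_def using assms by (intro mult_mono) auto
  then show "1 \<le> L * 3 powr (3 - \<gamma>)"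
    using \<gamma> mult_mono[of 1 L 1 "3 powr (3 - \<gamma>)"] by (simp add: ge_one_powr_ge_zero)
  show "0 < (3::real)" "0 \<le> 3 - \<gamma>" using \<gamma> by auto
  fix \<delta> :: real assume \<delta>: "0 < \<delta>" "\<delta> < 3"
  define \<eta> where "\<eta> = \<delta> / 3"
  have \<eta>: "0 < \<eta>" "\<eta> \<le> 1" "\<delta> = 3 * \<eta>" using \<delta> by (auto simp: \<eta>_def)
  have inv: "1 \<le> \<eta> powr - 1" "1 \<le> \<eta> powr (\<gamma> - 1)"
    using \<eta> \<gamma> powr_mono'[of "- 1" 0 \<eta>] powr_mono'[of "\<gamma> - 1" 0 \<eta>] by auto
  have absorb: "p * t + 1 \<le> (p + 1) * t" if "1 \<le> t" for p t :: real
    using that by (simp add: algebra_simps)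
  have "real (covering_number \<delta> (graph_on ({a..b} \<times> {c..d}) g))
      \<le> ((b - a) / \<eta> + 1) * ((d - c) / \<eta> + 1) * (2 * (C * \<eta> powr \<gamma>) / \<eta> + 1)"
    unfolding \<eta>(3) using assms(1,2) \<eta> osc by (intro covering_number_graph_le) auto
  also have "\<dots> = ((b - a) * \<eta> powr - 1 + 1) * ((d - c) * \<eta> powr - 1 + 1) * (2 * C * \<eta> powr (\<gamma> - 1) + 1)"
    using \<eta> by (simp add: powr_diff powr_minus field_simps)
  also have "\<dots> \<le> ((b - a + 1) * \<eta> powr - 1) * ((d - c + 1) * \<eta> powr - 1) * ((2 * C + 1) * \<eta> powr (\<gamma> - 1))"
    using assms(1-3) inv by (intro mult_mono absorb mult_nonneg_nonneg) auto
  also have "\<dots> = L * (\<eta> powr - 1 * \<eta> powr - 1 * \<eta> powr (\<gamma> - 1))"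
    by (simp add: L_def mult_ac)
  also have "\<dots> = L * \<eta> powr - (3 - \<gamma>)"
    by (simp only: powr_add[symmetric]) (simp add: algebra_simps)
  also have "\<dots> = L * 3 powr (3 - \<gamma>) * \<delta> powr - (3 - \<gamma>)"
    using \<eta> by (simp add: powr_mult powr_add[symmetric] flip: mult.assoc)
  finally show "real (covering_number \<delta> (graph_on ({a..b} \<times> {c..d}) g)) \<le> L * 3 powr (3 - \<gamma>) * \<delta> powr - (3 - \<gamma>)" .
qed

lemma bounded_graph_on:
  fixes g :: "real \<times> real \<Rightarrow> real"
  assumes "\<And>x y. (x, y) \<in> {a..b} \<times> {c..d} \<Longrightarrow> \<bar>g (x, y)\<bar> \<le> B"
  shows "bounded (graph_on ({a..b} \<times> {c..d}) g)"
  unfolding bounded_def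
proof (intro exI ballI)
  fix p assume "p \<in> graph_on ({a..b} \<times> {c..d}) g"
  then obtain x y where p: "p = vector [x, y, g (x, y)]" and xy: "x \<in> {a..b}" "y \<in> {c..d}"
    by (auto simp: graph_on_def)
  then show "dist (vector [a, c, 0]) p \<le> (b - a) + (d - c) + B"
    using dist_vector_3_le[of a c 0 x y "g (x, y)"] assms[of x y] by auto
qed

section \<open>Hoelder continuity of fractional integrals\<close>

text \<open>
  The kernel is singular at \<open>u = x\<close>, but its antiderivative \<open>- (x - u) powr \<gamma> / \<gamma>\<close> is continuous up to
  that point, so the fundamental theorem of calculus applies on the open interval. As the kernel is
  nonnegative, its gauge integral is a Lebesgue integral.
\<close>

lemma abel_kernel_integral:
  fixes \<gamma> p q x :: real
  assumes \<gamma>: "0 < \<gamma>" and "p \<le> q" "q \<le> x"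
  shows "set_integrable lborel {p..q} (\<lambda>u. (x - u) powr (\<gamma> - 1))"
    and "(LINT u:{p..q}|lborel. (x - u) powr (\<gamma> - 1)) = ((x - p) powr \<gamma> - (x - q) powr \<gamma>) / \<gamma>"
proof -
  let ?k = "\<lambda>u. (x - u) powr (\<gamma> - 1)"
  have hi: "(?k has_integral (- ((x - q) powr \<gamma> / \<gamma>) - - ((x - p) powr \<gamma> / \<gamma>))) {p..q}"
  proof (rule fundamental_theorem_of_calculus_interior [OF \<open>p \<le> q\<close>])
    show "continuous_on {p..q} (\<lambda>u. - ((x - u) powr \<gamma> / \<gamma>))"
      using assms by (intro continuous_intros continuous_on_powr') auto
  next
    fix u assume "u \<in> {p<..<q}"
    then have "x - u > 0" using assms by auto
    then have "((\<lambda>u. - ((x - u) powr \<gamma> / \<gamma>)) has_real_derivative ?k u) (at u)"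
      using \<gamma> by (auto intro!: derivative_eq_intros simp: field_simps powr_diff)
    then show "((\<lambda>u. - ((x - u) powr \<gamma> / \<gamma>)) has_vector_derivative ?k u) (at u)"
      by (simp add: has_real_derivative_iff_has_vector_derivative)
  qed
  then have "?k absolutely_integrable_on {p..q}"
    by (intro nonnegative_absolutely_integrable_1) (auto simp: has_integral_iff)
  then show int: "set_integrable lborel {p..q} ?k"
    unfolding set_integrable_def by (subst (asm) integrable_completion) auto
  show "(LINT u:{p..q}|lborel. ?k u) = ((x - p) powr \<gamma> - (x - q) powr \<gamma>) / \<gamma>"
    using hi set_borel_integral_eq_integral(2)[OF int] by (simp add: has_integral_iff diff_divide_distrib)
qed

lemma abel_integrand_integrable:
  fixes \<gamma> p q x M :: real
  assumes "0 < \<gamma>" "p \<le> q" "q \<le> x"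
    and h: "set_borel_measurable lborel {p..q} h" and M: "\<And>u. u \<in> {p..q} \<Longrightarrow> \<bar>h u\<bar> \<le> M"
  shows "set_integrable lborel {p..q} (\<lambda>u. (x - u) powr (\<gamma> - 1) * h u)"
proof (rule set_integrable_bound)
  show "set_integrable lborel {p..q} (\<lambda>u. M * (x - u) powr (\<gamma> - 1))"
    using abel_kernel_integral(1)[OF assms(1-3)] by auto
  have "(\<lambda>u. (x - u) powr (\<gamma> - 1) * (indicator {p..q} u *\<^sub>R h u)) \<in> borel_measurable lborel"
    using h unfolding set_borel_measurable_def by measurable
  then show "set_borel_measurable lborel {p..q} (\<lambda>u. (x - u) powr (\<gamma> - 1) * h u)"
    unfolding set_borel_measurable_def by (simp add: mult.left_commute)
  have "\<bar>(x - u) powr (\<gamma> - 1) * h u\<bar> \<le> \<bar>M * (x - u) powr (\<gamma> - 1)\<bar>" if "u \<in> {p..q}" for u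
    using mult_right_mono[OF order_trans[OF M[OF that] abs_ge_self], of "(x - u) powr (\<gamma> - 1)"]
    by (simp add: abs_mult mult.commute)
  then show "AE u in lborel. u \<in> {p..q} \<longrightarrow>
      norm ((x - u) powr (\<gamma> - 1) * h u) \<le> norm (M * (x - u) powr (\<gamma> - 1))"
    by auto
qed

lemma abel_integral_bound:
  fixes \<gamma> p q x M :: real
  assumes "0 < \<gamma>" "p \<le> q" "q \<le> x"
    and "set_borel_measurable lborel {p..q} h" and M: "\<And>u. u \<in> {p..q} \<Longrightarrow> \<bar>h u\<bar> \<le> M"
  shows "\<bar>LINT u:{p..q}|lborel. (x - u) powr (\<gamma> - 1) * h u\<bar>
    \<le> M * (((x - p) powr \<gamma> - (x - q) powr \<gamma>) / \<gamma>)"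
proof -
  note int = abel_integrand_integrable[OF assms]
  have "\<bar>LINT u:{p..q}|lborel. (x - u) powr (\<gamma> - 1) * h u\<bar>
      \<le> (LINT u:{p..q}|lborel. \<bar>(x - u) powr (\<gamma> - 1) * h u\<bar>)"
    using set_integral_norm_bound[OF int] by simp
  also have "\<dots> \<le> (LINT u:{p..q}|lborel. M * (x - u) powr (\<gamma> - 1))"
  proof (rule set_integral_mono)
    show "set_integrable lborel {p..q} (\<lambda>u. \<bar>(x - u) powr (\<gamma> - 1) * h u\<bar>)"
      by (rule set_integrable_abs[OF int])
    show "set_integrable lborel {p..q} (\<lambda>u. M * (x - u) powr (\<gamma> - 1))"
      using abel_kernel_integral(1)[OF assms(1-3)] by auto
    show "\<bar>(x - u) powr (\<gamma> - 1) * h u\<bar> \<le> M * (x - u) powr (\<gamma> - 1)" if "u \<in> {p..q}" for u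
      using mult_right_mono[OF M[OF that], of "(x - u) powr (\<gamma> - 1)"]
      by (simp add: abs_mult mult.commute)
  qed
  also have "\<dots> = M * (((x - p) powr \<gamma> - (x - q) powr \<gamma>) / \<gamma>)"
    using abel_kernel_integral(2)[OF assms(1-3)] by simp
  finally show ?thesis .
qed

text \<open>
  The one-dimensional Riemann-Liouville integral, without its normalising factor \<open>1 / Gamma \<gamma>\<close>.
\<close>

definition abel :: "real \<Rightarrow> real \<Rightarrow> (real \<Rightarrow> real) \<Rightarrow> real \<Rightarrow> real" where
  "abel \<gamma> p h x = (LINT u:{p..x}|lborel. (x - u) powr (\<gamma> - 1) * h u)"

lemma set_borel_measurable_Icc_subset:
  fixes h :: "real \<Rightarrow> real"
  assumes "set_borel_measurable lborel {p..r} h" "p \<le> q" "s \<le> r"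
  shows "set_borel_measurable lborel {q..s} h"
  by (rule set_borel_measurable_subset[OF assms(1)]) (use assms in auto)

lemma abel_bound:
  fixes \<gamma> p x M :: real
  assumes "0 < \<gamma>" "p \<le> x"
    and "set_borel_measurable lborel {p..x} h" and "\<And>u. u \<in> {p..x} \<Longrightarrow> \<bar>h u\<bar> \<le> M"
  shows "\<bar>abel \<gamma> p h x\<bar> \<le> M / \<gamma> * (x - p) powr \<gamma>"
  using abel_integral_bound[of \<gamma> p x x h M] assms unfolding abel_def by simp

lemma abel_diff:
  fixes \<gamma> p x M N :: real
  assumes "0 < \<gamma>" "p \<le> x"
    and "set_borel_measurable lborel {p..x} h" "\<And>u. u \<in> {p..x} \<Longrightarrow> \<bar>h u\<bar> \<le> M"
    and "set_borel_measurable lborel {p..x} k" "\<And>u. u \<in> {p..x} \<Longrightarrow> \<bar>k u\<bar> \<le> N"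
  shows "abel \<gamma> p h x - abel \<gamma> p k x = abel \<gamma> p (\<lambda>u. h u - k u) x"
  unfolding abel_def right_diff_distrib
  by (rule set_integral_diff(2)[symmetric]) (rule abel_integrand_integrable; use assms in auto)+

text \<open>
  For \<open>x \<le> x'\<close> the difference consists of the integral over the new piece \<open>{x..x'}\<close>, at most
  \<open>M / \<gamma> * (x' - x) powr \<gamma>\<close>, and the effect of the changed kernel on \<open>{p..x}\<close>. Because
  \<open>\<gamma> \<le> 1\<close> the kernel decreases pointwise when \<open>x\<close> is replaced by \<open>x'\<close>, so this effect is at most
  \<open>M\<close> times the difference of the two kernel integrals, which has the same bound since
  \<open>(x - p) powr \<gamma> \<le> (x' - p) powr \<gamma>\<close>.
\<close>

lemma abel_holder:
  fixes \<gamma> p r M :: real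
  assumes \<gamma>: "0 < \<gamma>" "\<gamma> \<le> 1" and xr: "x \<in> {p..r}" "x' \<in> {p..r}"
    and h: "set_borel_measurable lborel {p..r} h" and M: "\<And>u. u \<in> {p..r} \<Longrightarrow> \<bar>h u\<bar> \<le> M"
  shows "\<bar>abel \<gamma> p h x - abel \<gamma> p h x'\<bar> \<le> 2 * M / \<gamma> * \<bar>x - x'\<bar> powr \<gamma>"
  using xr
proof (induction x x' rule: linorder_wlog)
  case (sym x x')
  then show ?case by (simp add: abs_minus_commute)
next
  case (le x x')
  then have px: "p \<le> x" "x \<le> x'" "x' \<le> r" by auto
  have "0 \<le> M" using M[of x] px by auto
  have hm: "set_borel_measurable lborel {p..x} h" "set_borel_measurable lborel {x..x'} h"
    using px by (auto intro: set_borel_measurable_Icc_subset[OF h])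
  have Mb: "\<And>u. u \<in> {p..x} \<Longrightarrow> \<bar>h u\<bar> \<le> M" "\<And>u. u \<in> {x..x'} \<Longrightarrow> \<bar>h u\<bar> \<le> M"
    using M px by auto
  let ?K = "\<lambda>u. (x' - u) powr (\<gamma> - 1)" and ?k = "\<lambda>u. (x - u) powr (\<gamma> - 1)"
  have i1: "set_integrable lborel {p..x} (\<lambda>u. ?K u * h u)"
    by (rule abel_integrand_integrable[OF _ _ _ hm(1) Mb(1)]) (use \<gamma> px in auto)
  have i2: "set_integrable lborel {x..x'} (\<lambda>u. ?K u * h u)"
    by (rule abel_integrand_integrable[OF _ _ _ hm(2) Mb(2)]) (use \<gamma> px in auto)
  have i3: "set_integrable lborel {p..x} (\<lambda>u. ?k u * h u)"
    by (rule abel_integrand_integrable[OF _ _ _ hm(1) Mb(1)]) (use \<gamma> px in auto)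
  have k1: "set_integrable lborel {p..x} ?K" "set_integrable lborel {p..x} ?k"
    using abel_kernel_integral(1)[of \<gamma> p x] \<gamma> px by auto
  have "{p..x'} = {p..x} \<union> {x..x'}" using px by auto
  then have "abel \<gamma> p h x' = (LINT u:{p..x} \<union> {x..x'}|lborel. ?K u * h u)"
    by (simp add: abel_def)
  also have "\<dots> = (LINT u:{p..x}|lborel. ?K u * h u) + (LINT u:{x..x'}|lborel. ?K u * h u)"
  proof (rule set_integral_Un_AE[OF _ _ _ i1 i2])
    show "AE u in lborel. \<not> (u \<in> {p..x} \<and> u \<in> {x..x'})"
      using AE_lborel_singleton[of x] by eventually_elim auto
  qed auto
  finally have split: "abel \<gamma> p h x - abel \<gamma> p h x' =
      (LINT u:{p..x}|lborel. ?k u * h u - ?K u * h u) - (LINT u:{x..x'}|lborel. ?K u * h u)"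
    using set_integral_diff(2)[OF i3 i1] by (simp add: abel_def)
  have "\<bar>LINT u:{p..x}|lborel. ?k u * h u - ?K u * h u\<bar>
      \<le> (LINT u:{p..x}|lborel. \<bar>?k u * h u - ?K u * h u\<bar>)"
    using set_integral_norm_bound[OF set_integral_diff(1)[OF i3 i1]] by simp
  also have "\<dots> \<le> (LINT u:{p..x}|lborel. M * (?k u - ?K u))"
  proof (rule set_integral_mono_AE)
    show "set_integrable lborel {p..x} (\<lambda>u. \<bar>?k u * h u - ?K u * h u\<bar>)"
      by (rule set_integrable_abs[OF set_integral_diff(1)[OF i3 i1]])
    show "set_integrable lborel {p..x} (\<lambda>u. M * (?k u - ?K u))"
      using set_integral_diff(1)[OF k1(2,1)] by auto
    show "AE u \<in> {p..x} in lborel. \<bar>?k u * h u - ?K u * h u\<bar> \<le> M * (?k u - ?K u)"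
      \<comment> \<open>at \<open>u = x\<close> the estimate fails in general, since there \<open>0 powr (\<gamma> - 1) = 0\<close>\<close>
      using AE_lborel_singleton[of x]
    proof (eventually_elim, intro impI)
      fix u assume "u \<noteq> x" and u: "u \<in> {p..x}"
      then have "?K u \<le> ?k u"
        using px \<gamma> by (intro powr_mono2') auto
      then have "\<bar>(?k u - ?K u) * h u\<bar> \<le> (?k u - ?K u) * M"
        using Mb(1)[OF u] by (auto simp: abs_mult intro!: mult_left_mono)
      then show "\<bar>?k u * h u - ?K u * h u\<bar> \<le> M * (?k u - ?K u)"
        by (simp add: algebra_simps)
    qed
  qed
  also have "\<dots> = M * (((x - p) powr \<gamma> - (x' - p) powr \<gamma> + (x' - x) powr \<gamma>) / \<gamma>)"
    using abel_kernel_integral(2)[of \<gamma> p x x] abel_kernel_integral(2)[of \<gamma> p x x'] \<gamma> px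
    by (simp only: set_integral_mult_right set_integral_diff(2)[OF k1(2,1)])
      (simp add: diff_divide_distrib add_divide_distrib)
  also have "\<dots> \<le> M * ((x' - x) powr \<gamma> / \<gamma>)"
    using \<open>0 \<le> M\<close> \<gamma> px by (intro mult_left_mono divide_right_mono) (auto intro!: powr_mono2)
  finally have first: "\<bar>LINT u:{p..x}|lborel. ?k u * h u - ?K u * h u\<bar> \<le> M / \<gamma> * (x' - x) powr \<gamma>"
    by simp
  have "\<bar>LINT u:{x..x'}|lborel. ?K u * h u\<bar> \<le> M / \<gamma> * (x' - x) powr \<gamma>"
    using abel_integral_bound[OF _ _ _ hm(2) Mb(2), where x=x' and \<gamma>=\<gamma>] \<gamma> px by simp
  with first split have "\<bar>abel \<gamma> p h x - abel \<gamma> p h x'\<bar> \<le> 2 * (M / \<gamma> * (x' - x) powr \<gamma>)"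
    by linarith
  then show ?case
    using px by (simp add: abs_minus_commute)
qed

section \<open>Hoelder continuity of the mixed fractional integral\<close>

lemma mixed_RL_integral_eq_abel:
  "mixed_RL_integral a c (\<gamma>\<^sub>1, \<gamma>\<^sub>2) f (x, y) =
    1 / (Gamma \<gamma>\<^sub>1 * Gamma \<gamma>\<^sub>2) * abel \<gamma>\<^sub>1 a (\<lambda>u. abel \<gamma>\<^sub>2 c (\<lambda>v. f (u, v)) y) x"
  by (simp add: mixed_RL_integral_def abel_def mult.assoc)

lemma section_measurable:
  fixes f :: "real \<times> real \<Rightarrow> real"
  assumes f: "continuous_on ({a..b} \<times> {c..d}) f" and u: "u \<in> {a..b}" and "y \<le> d"
  shows "set_borel_measurable lborel {c..y} (\<lambda>v. f (u, v))"
proof -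
  have "continuous_on {c..y} (f \<circ> (\<lambda>v. (u, v)))"
    by (intro continuous_on_compose continuous_intros continuous_on_subset[OF f]) (use assms in auto)
  then show ?thesis
    using borel_measurable_continuous_on_indicator[of "{c..y}" "\<lambda>v. f (u, v)"]
    by (simp add: set_borel_measurable_def o_def)
qed

text \<open>
  A parameter integral of a jointly measurable function is measurable in the parameter. Joint
  measurability is obtained by extending \<open>f\<close> by 0 outside the rectangle, which changes nothing for
  \<open>u\<close> in \<open>{a..b}\<close> and \<open>v\<close> in \<open>{c..y}\<close>.
\<close>

lemma abel_section_measurable:
  fixes f :: "real \<times> real \<Rightarrow> real"
  assumes f: "continuous_on ({a..b} \<times> {c..d}) f" and y: "y \<le> d"
  shows "set_borel_measurable lborel {a..b} (\<lambda>u. abel \<gamma> c (\<lambda>v. f (u, v)) y)"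
proof -
  define F where "F = (\<lambda>z. indicator ({a..b} \<times> {c..d}) z *\<^sub>R f z)"
  have "F \<in> borel_measurable borel"
    unfolding F_def by (rule borel_measurable_continuous_on_indicator[OF _ f]) (simp add: borel_closed closed_Times)
  then have [measurable]: "F \<in> borel_measurable (lborel \<Otimes>\<^sub>M lborel)"
    by (simp add: borel_prod lborel_prod)
  have "(\<lambda>u. \<integral>v. indicator {c..y} v * ((y - v) powr (\<gamma> - 1) * F (u, v)) \<partial>lborel)
      \<in> borel_measurable lborel"
    by measurable
  moreover have "indicator {a..b} u *\<^sub>R abel \<gamma> c (\<lambda>v. f (u, v)) y =
      (\<integral>v. indicator {c..y} v * ((y - v) powr (\<gamma> - 1) * F (u, v)) \<partial>lborel)" for u
  proof (cases "u \<in> {a..b}")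
    case True
    then show ?thesis unfolding abel_def set_lebesgue_integral_def F_def
      using y by (auto intro!: Bochner_Integration.integral_cong simp: indicator_def)
  next
    case False
    then have "(\<integral>v. indicator {c..y} v * ((y - v) powr (\<gamma> - 1) * F (u, v)) \<partial>lborel) = (\<integral>v. 0 \<partial>(lborel::real measure))"
      by (intro Bochner_Integration.integral_cong) (auto simp: F_def)
    with False show ?thesis by simp
  qed
  ultimately show ?thesis
    unfolding set_borel_measurable_def by simp
qed

text \<open>
  The step from \<open>(x, y)\<close> to \<open>(x', y')\<close> is made via \<open>(x', y)\<close>. The inner integral \<open>H y\<close> is bounded by
  \<open>N\<close>, which gives the exponent \<open>\<gamma>\<^sub>1\<close> for the first half by \<open>abel_holder\<close>. The second half is the
  outer integral of \<open>H y - H y'\<close>, which is uniformly of order \<open>\<bar>y - y'\<bar> powr \<gamma>\<^sub>2\<close> by the same lemma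
  applied to the sections of \<open>f\<close>.
\<close>

lemma mixed_RL_integral_bounded_and_holder:
  fixes f :: "real \<times> real \<Rightarrow> real"
  assumes "a \<le> b" "c \<le> d" and \<gamma>: "0 < \<gamma>\<^sub>1" "\<gamma>\<^sub>1 \<le> 1" "0 < \<gamma>\<^sub>2" "\<gamma>\<^sub>2 \<le> 1"
    and f: "continuous_on ({a..b} \<times> {c..d}) f"
  obtains B C where "0 \<le> C"
    and "\<And>x y. (x, y) \<in> {a..b} \<times> {c..d} \<Longrightarrow> \<bar>mixed_RL_integral a c (\<gamma>\<^sub>1, \<gamma>\<^sub>2) f (x, y)\<bar> \<le> B"
    and "\<And>x y x' y'. (x, y) \<in> {a..b} \<times> {c..d} \<Longrightarrow> (x', y') \<in> {a..b} \<times> {c..d} \<Longrightarrow>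
      \<bar>mixed_RL_integral a c (\<gamma>\<^sub>1, \<gamma>\<^sub>2) f (x, y) - mixed_RL_integral a c (\<gamma>\<^sub>1, \<gamma>\<^sub>2) f (x', y')\<bar>
        \<le> C * (\<bar>x - x'\<bar> powr \<gamma>\<^sub>1 + \<bar>y - y'\<bar> powr \<gamma>\<^sub>2)"
proof -
  have "bounded (f ` ({a..b} \<times> {c..d}))"
    by (intro compact_imp_bounded compact_continuous_image[OF f] compact_Times) auto
  then obtain M where M: "\<And>u v. u \<in> {a..b} \<Longrightarrow> v \<in> {c..d} \<Longrightarrow> \<bar>f (u, v)\<bar> \<le> M"
    by (fastforce simp: bounded_real)
  have "0 \<le> M" using M[of a c] assms by auto
  define H where "H = (\<lambda>y u. abel \<gamma>\<^sub>2 c (\<lambda>v. f (u, v)) y)"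
  define G where "G = 1 / (Gamma \<gamma>\<^sub>1 * Gamma \<gamma>\<^sub>2)"
  define N where "N = M / \<gamma>\<^sub>2 * (d - c) powr \<gamma>\<^sub>2"
  define P where "P = (b - a) powr \<gamma>\<^sub>1 / \<gamma>\<^sub>1"
  have "0 \<le> G" using \<gamma> Gamma_real_pos by (simp add: G_def less_imp_le)
  have "0 \<le> N" "0 \<le> P" using \<open>0 \<le> M\<close> \<gamma> by (auto simp: N_def P_def)
  have Hm: "set_borel_measurable lborel {a..x} (H y)" if "x \<in> {a..b}" "y \<in> {c..d}" for x y
    using abel_section_measurable[OF f, of y \<gamma>\<^sub>2] that unfolding H_def
    by (auto intro: set_borel_measurable_Icc_subset)
  have HN: "\<bar>H y u\<bar> \<le> N" if "u \<in> {a..b}" "y \<in> {c..d}" for u y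
  proof -
    have "\<bar>H y u\<bar> \<le> M / \<gamma>\<^sub>2 * (y - c) powr \<gamma>\<^sub>2"
      unfolding H_def
      by (rule abel_bound) (use that \<gamma> M section_measurable[OF f] in auto)
    also have "\<dots> \<le> N" unfolding N_def
      using that \<gamma> \<open>0 \<le> M\<close> by (intro mult_left_mono powr_mono2) auto
    finally show ?thesis .
  qed
  have Hd: "\<bar>H y u - H y' u\<bar> \<le> 2 * M / \<gamma>\<^sub>2 * \<bar>y - y'\<bar> powr \<gamma>\<^sub>2"
    if "u \<in> {a..b}" "y \<in> {c..d}" "y' \<in> {c..d}" for u y y'
    unfolding H_def by (rule abel_holder) (use that \<gamma> M section_measurable[OF f] in auto)
  have outer: "\<bar>abel \<gamma>\<^sub>1 a h x\<bar> \<le> L * P"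
    if "x \<in> {a..b}" "set_borel_measurable lborel {a..x} h" "\<And>u. u \<in> {a..b} \<Longrightarrow> \<bar>h u\<bar> \<le> L" for h x L
  proof -
    have "0 \<le> L" using that(3)[of a] assms by auto
    have "\<bar>abel \<gamma>\<^sub>1 a h x\<bar> \<le> L / \<gamma>\<^sub>1 * (x - a) powr \<gamma>\<^sub>1"
      by (rule abel_bound) (use that \<gamma> in auto)
    also have "\<dots> \<le> L / \<gamma>\<^sub>1 * (b - a) powr \<gamma>\<^sub>1"
      using that(1) \<gamma> \<open>0 \<le> L\<close> by (intro mult_left_mono powr_mono2) auto
    finally show ?thesis by (simp add: P_def)
  qed
  have mixed: "mixed_RL_integral a c (\<gamma>\<^sub>1, \<gamma>\<^sub>2) f (x, y) = G * abel \<gamma>\<^sub>1 a (H y) x" for x y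
    by (simp add: mixed_RL_integral_eq_abel H_def G_def)
  define C where "C = G * (2 * N / \<gamma>\<^sub>1 + 2 * M / \<gamma>\<^sub>2 * P)"
  show ?thesis
  proof
    show "0 \<le> C" unfolding C_def using \<open>0 \<le> G\<close> \<open>0 \<le> N\<close> \<open>0 \<le> M\<close> \<open>0 \<le> P\<close> \<gamma> by auto
    show "\<bar>mixed_RL_integral a c (\<gamma>\<^sub>1, \<gamma>\<^sub>2) f (x, y)\<bar> \<le> G * (N * P)"
      if "(x, y) \<in> {a..b} \<times> {c..d}" for x y
      using outer[of x "H y" N] that Hm HN \<open>0 \<le> G\<close>
      by (auto simp: mixed abs_mult intro!: mult_left_mono)
    fix x y x' y' assume xy: "(x, y) \<in> {a..b} \<times> {c..d}" "(x', y') \<in> {a..b} \<times> {c..d}"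
    let ?X = "\<bar>x - x'\<bar> powr \<gamma>\<^sub>1" and ?Y = "\<bar>y - y'\<bar> powr \<gamma>\<^sub>2"
    have merge: "A * X + B * Y * Q \<le> (A + B * Q) * (X + Y)"
      if "0 \<le> A" "0 \<le> B" "0 \<le> Q" "0 \<le> X" "0 \<le> Y" for A B Q X Y :: real
      using that by (simp add: algebra_simps)
    have 1: "\<bar>abel \<gamma>\<^sub>1 a (H y) x - abel \<gamma>\<^sub>1 a (H y) x'\<bar> \<le> 2 * N / \<gamma>\<^sub>1 * ?X"
      by (rule abel_holder[where r=b]) (use xy \<gamma> HN Hm[of b y] assms in auto)
    have m: "set_borel_measurable lborel {a..x'} (H y)" "set_borel_measurable lborel {a..x'} (H y')"
      using Hm xy by auto
    then have "set_borel_measurable lborel {a..x'} (\<lambda>u. H y u - H y' u)"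
      unfolding set_borel_measurable_def right_diff_distrib real_scaleR_def by measurable
    moreover have "abel \<gamma>\<^sub>1 a (H y) x' - abel \<gamma>\<^sub>1 a (H y') x' = abel \<gamma>\<^sub>1 a (\<lambda>u. H y u - H y' u) x'"
      by (rule abel_diff[where M=N and N=N, OF _ _ m(1) _ m(2)]) (use xy \<gamma> HN in auto)
    ultimately have 2: "\<bar>abel \<gamma>\<^sub>1 a (H y) x' - abel \<gamma>\<^sub>1 a (H y') x'\<bar> \<le> 2 * M / \<gamma>\<^sub>2 * ?Y * P"
      using outer[of x' "\<lambda>u. H y u - H y' u" "2 * M / \<gamma>\<^sub>2 * ?Y"] xy Hd by simp
    have "\<bar>abel \<gamma>\<^sub>1 a (H y) x - abel \<gamma>\<^sub>1 a (H y') x'\<bar> \<le> 2 * N / \<gamma>\<^sub>1 * ?X + 2 * M / \<gamma>\<^sub>2 * ?Y * P"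
      using 1 2 by linarith
    also have "\<dots> \<le> (2 * N / \<gamma>\<^sub>1 + 2 * M / \<gamma>\<^sub>2 * P) * (?X + ?Y)"
      using \<open>0 \<le> N\<close> \<open>0 \<le> M\<close> \<open>0 \<le> P\<close> \<gamma> by (intro merge) auto
    finally have "G * \<bar>abel \<gamma>\<^sub>1 a (H y) x - abel \<gamma>\<^sub>1 a (H y') x'\<bar> \<le> C * (?X + ?Y)"
      using \<open>0 \<le> G\<close> by (simp add: C_def mult.assoc mult_left_mono)
    moreover have "mixed_RL_integral a c (\<gamma>\<^sub>1, \<gamma>\<^sub>2) f (x, y) - mixed_RL_integral a c (\<gamma>\<^sub>1, \<gamma>\<^sub>2) f (x', y')
        = G * (abel \<gamma>\<^sub>1 a (H y) x - abel \<gamma>\<^sub>1 a (H y') x')"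
      by (simp add: mixed right_diff_distrib)
    ultimately show "\<bar>mixed_RL_integral a c (\<gamma>\<^sub>1, \<gamma>\<^sub>2) f (x, y) - mixed_RL_integral a c (\<gamma>\<^sub>1, \<gamma>\<^sub>2) f (x', y')\<bar>
        \<le> C * (?X + ?Y)"
      using \<open>0 \<le> G\<close> by (simp add: abs_mult)
  qed
qed

section \<open>Dimensions of the graph of the mixed fractional integral\<close>

theorem theorem3p1:
  fixes a b c d \<gamma>\<^sub>1 \<gamma>\<^sub>2 :: real and f :: "real \<times> real \<Rightarrow> real"
  assumes "0 < a" and "a < b" and "0 < c" and "c < d"
    and "0 < \<gamma>\<^sub>1" and "\<gamma>\<^sub>1 < 1" and "0 < \<gamma>\<^sub>2" and "\<gamma>\<^sub>2 < 1"
    and "continuous_on ({a..b} \<times> {c..d}) f"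
  shows "hausdorff_dim (graph_on ({a..b} \<times> {c..d}) (mixed_RL_integral a c (\<gamma>\<^sub>1, \<gamma>\<^sub>2) f))
           \<le> upper_box_dim (graph_on ({a..b} \<times> {c..d}) (mixed_RL_integral a c (\<gamma>\<^sub>1, \<gamma>\<^sub>2) f))
       \<and> upper_box_dim (graph_on ({a..b} \<times> {c..d}) (mixed_RL_integral a c (\<gamma>\<^sub>1, \<gamma>\<^sub>2) f))
           \<le> ereal (3 - min \<gamma>\<^sub>1 \<gamma>\<^sub>2)"
proof -
  let ?g = "mixed_RL_integral a c (\<gamma>\<^sub>1, \<gamma>\<^sub>2) f"
  let ?\<gamma> = "min \<gamma>\<^sub>1 \<gamma>\<^sub>2"
  obtain B C where C: "0 \<le> C"
    and B: "\<And>x y. (x, y) \<in> {a..b} \<times> {c..d} \<Longrightarrow> \<bar>?g (x, y)\<bar> \<le> B"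
    and holder: "\<And>x y x' y'. (x, y) \<in> {a..b} \<times> {c..d} \<Longrightarrow> (x', y') \<in> {a..b} \<times> {c..d} \<Longrightarrow>
      \<bar>?g (x, y) - ?g (x', y')\<bar> \<le> C * (\<bar>x - x'\<bar> powr \<gamma>\<^sub>1 + \<bar>y - y'\<bar> powr \<gamma>\<^sub>2)"
    by (rule mixed_RL_integral_bounded_and_holder[of a b c d \<gamma>\<^sub>1 \<gamma>\<^sub>2 f]) (use assms in auto)
  \<comment> \<open>below scale 1 the larger exponent may be lowered to the smaller one\<close>
  have lower: "t powr \<beta> \<le> \<eta> powr ?\<gamma>"
    if "0 \<le> t" "t \<le> \<eta>" "0 < \<eta>" "\<eta> \<le> 1" "\<beta> \<in> {\<gamma>\<^sub>1, \<gamma>\<^sub>2}" for t \<beta> \<eta> :: real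
  proof -
    have "t powr \<beta> \<le> \<eta> powr \<beta>"
      using that assms by (intro powr_mono2) auto
    also have "\<dots> \<le> \<eta> powr ?\<gamma>"
      using that by (intro powr_mono') auto
    finally show ?thesis .
  qed
  have "upper_box_dim (graph_on ({a..b} \<times> {c..d}) ?g) \<le> ereal (3 - ?\<gamma>)"
  proof (rule upper_box_dim_graph_le)
    show "0 \<le> 2 * C" using C by simp
    fix \<eta> x y x' y' :: real
    assume \<eta>: "0 < \<eta>" "\<eta> \<le> 1" "\<bar>x - x'\<bar> \<le> \<eta>" "\<bar>y - y'\<bar> \<le> \<eta>"
      and xy: "(x, y) \<in> {a..b} \<times> {c..d}" "(x', y') \<in> {a..b} \<times> {c..d}"
    have "\<bar>?g (x, y) - ?g (x', y')\<bar> \<le> C * (\<bar>x - x'\<bar> powr \<gamma>\<^sub>1 + \<bar>y - y'\<bar> powr \<gamma>\<^sub>2)"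
      by (rule holder[OF xy])
    also have "\<dots> \<le> C * (\<eta> powr ?\<gamma> + \<eta> powr ?\<gamma>)"
      using \<eta> C by (intro mult_left_mono add_mono lower) auto
    finally show "\<bar>?g (x, y) - ?g (x', y')\<bar> \<le> 2 * C * \<eta> powr ?\<gamma>"
      by simp
  qed (use assms in auto)
  moreover have "bounded (graph_on ({a..b} \<times> {c..d}) ?g)"
    using B by (rule bounded_graph_on)
  ultimately show ?thesis
    using hausdorff_dim_le_upper_box_dim by blast
qed

end
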